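(* Let $\mathcal{R}$ be a unital ring with involution, let $m\in\mathcal{R}$ be invertible with $m^*=m$, and let $a,b\in\mathcal{R}^{\mathrm{core},m}$. If $a^{\mathrm{core},m}b=b^{\mathrm{core},m}a$ and $a\,a^{\mathrm{core},m}=b\,a^{\mathrm{core},m}$, then $ab$ and $a^2$ have $m$-weighted core inverses and $$(ab)^{\mathrm{core},m}=b^{\mathrm{core},m}a^{\mathrm{core},m}=\left(a^{\mathrm{core},m}\right)^2=(a^2)^{\mathrm{core},m}.$$
   Context: $\mathcal{R}$ is a (not necessarily commutative) unital ring with an involution $x\mapsto x^*$ satisfying $(xy)^*=y^*x^*$, $(x+y)^*=x^*+y^*$, $(x^* )^*=x$. For an invertible $m\in\mathcal{R}$ with $m^*=m$, an element $z\in\mathcal{R}$ is the $m$-weighted core inverse of $a\in\mathcal{R}$ if $aza=a$, $z\mathcal{R}=a\mathcal{R}$ and $\mathcal{R}z=\mathcal{R}a^*m$. It is unique if it exists and is denoted $a^{\mathrm{core},m}$; $\mathcal{R}^{\mathrm{core},m}$ is the set of elements that have an $m$-weighted core inverse. *)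

theory Defs
  imports Main
begin

text \<open>
  The sort \<open>{ring, monoid_mult}\<close> is that of (not necessarily commutative) unital rings.
  It is used in place of \<open>ring_1\<close>, which would in addition require \<open>0 \<noteq> 1\<close>.
\<close>

locale ring_involution =
  fixes star :: "'a::{ring, monoid_mult} \<Rightarrow> 'a"
  assumes star_mult: "star (x * y) = star y * star x"
    and star_add: "star (x + y) = star x + star y"
    and star_star: "star (star x) = x"

text \<open>In a noncommutative ring, \<open>m dvd 1\<close> would only express one-sided invertibility.\<close>

definition two_sided_unit :: "'a::{ring, monoid_mult} \<Rightarrow> bool" where
  "two_sided_unit m \<longleftrightarrow> (\<exists>n. m * n = 1 \<and> n * m = 1)"

definition right_ideal :: "'a::{ring, monoid_mult} \<Rightarrow> 'a set" where
  "right_ideal x = {x * r | r. True}"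

definition left_ideal :: "'a::{ring, monoid_mult} \<Rightarrow> 'a set" where
  "left_ideal x = {r * x | r. True}"

definition is_wcore_inverse ::
    "('a::{ring, monoid_mult} \<Rightarrow> 'a) \<Rightarrow> 'a \<Rightarrow> 'a \<Rightarrow> 'a \<Rightarrow> bool" where
  "is_wcore_inverse star m a z \<longleftrightarrow>
     a * z * a = a \<and> right_ideal z = right_ideal a \<and> left_ideal z = left_ideal (star a * m)"

definition wcore_invertible ::
    "('a::{ring, monoid_mult} \<Rightarrow> 'a) \<Rightarrow> 'a \<Rightarrow> 'a set" where
  "wcore_invertible star m = {a. \<exists>z. is_wcore_inverse star m a z}"

text \<open>
  Meaningful for \<open>a \<in> wcore_invertible star m\<close> with \<open>m\<close> invertible and \<open>star m = m\<close>; the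
  weighted core inverse is then unique, see \<open>is_wcore_inverse_unique\<close> below.
\<close>

definition wcore_inverse ::
    "('a::{ring, monoid_mult} \<Rightarrow> 'a) \<Rightarrow> 'a \<Rightarrow> 'a \<Rightarrow> 'a" where
  "wcore_inverse star m a = (THE z. is_wcore_inverse star m a z)"

context ring_involution
begin

lemma is_wcore_inverse_props:
  assumes n: "m * n = 1" "n * m = 1" and m: "star m = m" and z: "is_wcore_inverse star m a z"
  shows "a * z * a = a" "z * a * z = z" "a * z * z = z" "z * a * a = a"
    "n * star (a * z) * m = a * z"
proof -
  show aza: "a * z * a = a"
    using z by (simp add: is_wcore_inverse_def)
  have R: "right_ideal z = right_ideal a" and L: "left_ideal z = left_ideal (star a * m)"
    using z by (simp_all add: is_wcore_inverse_def)
  have "z \<in> right_ideal z" "a \<in> right_ideal a" "z \<in> left_ideal z"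
    unfolding right_ideal_def left_ideal_def
    by (simp_all, (metis mult_1_left mult_1_right)+)
  with R L have "z \<in> right_ideal a" "a \<in> right_ideal z" "z \<in> left_ideal (star a * m)"
    by (simp_all only:)
  then have "\<exists>u. z = a * u" "\<exists>v. a = z * v" "\<exists>w. z = w * (star a * m)"
    unfolding right_ideal_def left_ideal_def by simp_all
  then obtain u v w where u: "z = a * u" and v: "a = z * v" and w: "z = w * (star a * m)"
    by (elim exE)
  have "a * z * (a * u) = a * u"
    using aza by (simp add: mult.assoc[symmetric])
  then show "a * z * z = z"
    by (simp only: u[symmetric])
  define p where "p = a * z"
  define q where "q = n * star p * m"
  have one: "star 1 = 1"
    using star_mult[of "star 1" 1] by (simp add: star_star)
  have sn: "star n = n"
  proof -
    have "m * star n = 1"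
      using star_mult[of n m] n(2) m one by simp
    then have "n * m * star n = n"
      by (simp add: mult.assoc)
    then show ?thesis
      using n(2) by simp
  qed
  have "star a * star p = star a"
    unfolding p_def star_mult[symmetric] aza ..
  then have "w * (star a * ((m * n) * (star p * m))) = w * (star a * m)"
    using n(1) by (simp add: mult.assoc[symmetric])
  then have "w * (star a * m) * q = w * (star a * m)"
    by (simp add: q_def mult.assoc)
  then have "z * q = z"
    by (simp only: w[symmetric])
  then have pq: "p * q = p"
    by (simp add: p_def mult.assoc)
  have sq: "star q = m * p * n"
    by (simp add: q_def star_mult star_star m sn mult.assoc)
  have sp: "star p = m * p * n * star p"
    using star_mult[of p q] unfolding pq sq .
  have "q = n * (m * p * n * star p) * m"
    unfolding q_def by (rule arg_cong[OF sp])
  also have "\<dots> = (n * m) * (p * (n * star p * m))"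
    by (simp add: mult.assoc)
  also have "\<dots> = p * q"
    by (simp add: n(2) q_def)
  finally have "q = p * q" .
  with pq have "q = p" by simp
  then show "n * star (a * z) * m = a * z"
    by (simp add: q_def p_def)
  show zaz: "z * a * z = z"
    using \<open>z * q = z\<close> \<open>q = p\<close> by (simp add: p_def mult.assoc)
  have "z * a * (z * v) = z * v"
    using zaz by (simp add: mult.assoc[symmetric])
  then show "z * a * a = a"
    by (simp only: v[symmetric])
qed

lemma is_wcore_inverse_unique:
  assumes m: "two_sided_unit m" "star m = m"
    and z: "is_wcore_inverse star m a z" and y: "is_wcore_inverse star m a y"
  shows "z = y"
proof -
  obtain n where n: "m * n = 1" "n * m = 1"
    using m(1) by (auto simp: two_sided_unit_def)
  note Z = is_wcore_inverse_props[OF n m(2) z]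
  note Y = is_wcore_inverse_props[OF n m(2) y]
  have "a * y * (a * z) = a * z" "a * z * (a * y) = a * y"
    using Z(1) Y(1) by (simp_all add: mult.assoc[symmetric])
  moreover have "n * star (a * z * (a * y)) * m = a * y * (a * z)"
  proof -
    have "n * star (a * z * (a * y)) * m = n * star (a * y) * (m * n) * star (a * z) * m"
      by (subst star_mult[of "a * z" "a * y"]) (simp add: n(1) mult.assoc)
    also have "\<dots> = n * star (a * y) * m * (n * star (a * z) * m)"
      by (simp add: mult.assoc)
    finally show ?thesis using Z(5) Y(5) by simp
  qed
  ultimately have ay: "a * y = a * z"
    using Y(5) by simp
  have "y = a * y * y"
    by (simp add: Y(3))
  also have "\<dots> = z * a * (a * y * y)"
    using Z(4) by (simp add: mult.assoc[symmetric])
  also have "\<dots> = z * (a * y)"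
    using Y(3) by (simp add: mult.assoc)
  also have "\<dots> = z"
    using ay Z(2) by (simp add: mult.assoc)
  finally show ?thesis by simp
qed

lemma wcore_inverse_eqI:
  assumes "two_sided_unit m" "star m = m" "is_wcore_inverse star m a z"
  shows "wcore_inverse star m a = z"
  unfolding wcore_inverse_def
  by (rule the_equality, rule assms(3)) (rule is_wcore_inverse_unique[OF assms(1,2) _ assms(3)])

end

end

theory Submission
  imports Defs
begin

text \<open>
  Write \<open>x\<close> and \<open>y\<close> for the weighted core inverses of \<open>a\<close> and \<open>b\<close>. The weighted core inverse of \<open>a\<close>
  satisfies \<open>a * x * x = x\<close> and \<open>x * a * a = a\<close>, so \<open>a\<close> and \<open>x\<close> undo each other on the right ideal
  that they both generate; in particular \<open>a * a * (x * x) = a * x\<close>. The condition \<open>b * x = a * x\<close> lets \<open>b\<close> stand in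
  for the second factor \<open>a\<close>, so also \<open>a * b * (x * x) = a * x\<close>. Hence both products have the same
  idempotent \<open>a * x\<close>, self-adjoint for the weight, as their product with \<open>x * x\<close>, and this makes
  \<open>x * x\<close> the weighted core inverse of both (\<open>is_wcore_inverse_mult\<close>, taken with \<open>d = a\<close> and with
  \<open>d = b\<close>). The condition \<open>x * b = y * a\<close> identifies \<open>y * x\<close> with \<open>x * x\<close>:
  \<open>y * x = y * a * x * x = x * b * x * x = x * a * x * x = x * x\<close>.
\<close>

context ring_involution
begin

text \<open>
  A converse to \<open>is_wcore_inverse_props\<close>. The two equalities of ideals become equations in the ring:
  the right ideals agree because \<open>z\<close> and \<open>c\<close> are right multiples of each other, and the
  self-adjointness of \<open>c * z\<close> with respect to the weight turns \<open>z = z * (c * z)\<close> and the adjoint of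
  \<open>c = c * z * c\<close> into expressions of \<open>z\<close> and \<open>star c * m\<close> as left multiples of each other.
\<close>

lemma is_wcore_inverseI:
  assumes n: "m * n = 1"
    and czc: "c * z * c = c" and zcz: "z * c * z = z" and czz: "c * z * z = z"
    and v: "c = z * v" and herm: "n * star (c * z) * m = c * z"
  shows "is_wcore_inverse star m c z"
proof -
  have "z * r = c * (z * z * r)" for r
    using czz by (simp add: mult.assoc[symmetric])
  moreover have "c * r = z * (v * r)" for r
    using v by (simp add: mult.assoc[symmetric])
  ultimately have R: "right_ideal z = right_ideal c"
    unfolding right_ideal_def by blast
  have "z = z * (c * z)"
    using zcz by (simp add: mult.assoc)
  also have "\<dots> = z * (n * star (c * z) * m)"
    by (simp only: herm)
  also have "\<dots> = z * n * star z * (star c * m)"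
    by (simp add: star_mult mult.assoc)
  finally have zl: "z = z * n * star z * (star c * m)" .
  have "star c * m = star (c * z * c) * m"
    by (simp only: czc)
  also have "\<dots> = star c * (m * n) * star (c * z) * m"
    by (subst star_mult) (simp add: n)
  also have "\<dots> = star c * m * (n * star (c * z) * m)"
    by (simp add: mult.assoc)
  also have "\<dots> = star c * m * c * z"
    unfolding herm by (simp add: mult.assoc)
  finally have cl: "star c * m = star c * m * c * z" .
  have "r * z = (r * (z * n * star z)) * (star c * m)" for r
    using arg_cong[OF zl, of "\<lambda>t. r * t"] by (simp only: mult.assoc)
  moreover have "r * (star c * m) = (r * (star c * m * c)) * z" for r
    using arg_cong[OF cl, of "\<lambda>t. r * t"] by (simp only: mult.assoc)
  ultimately have L: "left_ideal z = left_ideal (star c * m)"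
    unfolding left_ideal_def by blast
  show ?thesis
    unfolding is_wcore_inverse_def using czc R L by blast
qed

text \<open>
  Since \<open>x\<close> generates the right ideal of \<open>a\<close>, the condition \<open>d * x = a * x\<close> says that \<open>d\<close> and \<open>a\<close> act
  alike on it by left multiplication. The product \<open>a * d\<close> therefore sends \<open>x * x\<close> to the same
  projection \<open>a * x\<close> as \<open>a * a\<close> does.
\<close>

lemma is_wcore_inverse_mult:
  assumes m: "two_sided_unit m" "star m = m"
    and x: "is_wcore_inverse star m a x" and dx: "d * x = a * x"
  shows "is_wcore_inverse star m (a * d) (x * x)"
proof -
  obtain n where n: "m * n = 1" "n * m = 1"
    using m(1) by (auto simp: two_sided_unit_def)
  note X = is_wcore_inverse_props[OF n m(2) x]
  have "a * d * (x * x) = a * (d * x) * x"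
    by (simp add: mult.assoc)
  also have "\<dots> = a * (a * x * x)"
    by (simp add: dx mult.assoc)
  finally have proj: "a * d * (x * x) = a * x"
    by (simp only: X(3))
  show ?thesis
  proof (rule is_wcore_inverseI[OF n(1)])
    show "a * d * (x * x) * (a * d) = a * d"
      unfolding proj using X(1) by (simp add: mult.assoc[symmetric])
    have "x * x * (a * d) * (x * x) = x * (x * (a * d * (x * x)))"
      by (simp add: mult.assoc)
    also have "\<dots> = x * (x * a * x)"
      unfolding proj by (simp add: mult.assoc)
    finally show "x * x * (a * d) * (x * x) = x * x"
      by (simp only: X(2))
    show "a * d * (x * x) * (x * x) = x * x"
      unfolding proj using X(3) by (simp add: mult.assoc[symmetric])
    \<comment> \<open>Applying \<open>a = x * a * a\<close> twice pulls \<open>x * x\<close> out of \<open>a\<close> on the left.\<close>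
    have "x * x * (a * a * a * d) = x * (x * a * a) * a * d"
      by (simp add: mult.assoc)
    also have "\<dots> = a * d"
      by (simp only: X(4))
    finally show "a * d = x * x * (a * a * a * d)" ..
    show "n * star (a * d * (x * x)) * m = a * d * (x * x)"
      unfolding proj by (rule X(5))
  qed
qed

end

theorem theorem4p1:
  fixes star :: "'a::{ring, monoid_mult} \<Rightarrow> 'a" and m a b :: 'a
  assumes "ring_involution star"
    and "two_sided_unit m" and "star m = m"
    and "a \<in> wcore_invertible star m" and "b \<in> wcore_invertible star m"
    and "wcore_inverse star m a * b = wcore_inverse star m b * a"
    and "a * wcore_inverse star m a = b * wcore_inverse star m a"
  shows "a * b \<in> wcore_invertible star m \<and> a^2 \<in> wcore_invertible star m
    \<and> wcore_inverse star m (a * b) = wcore_inverse star m b * wcore_inverse star m a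
    \<and> wcore_inverse star m b * wcore_inverse star m a = (wcore_inverse star m a)^2
    \<and> (wcore_inverse star m a)^2 = wcore_inverse star m (a^2)"
proof -
  interpret ring_involution star by (rule assms(1))
  note m = assms(2,3)
  define x where "x = wcore_inverse star m a"
  define y where "y = wcore_inverse star m b"
  have xb: "x * b = y * a" and bx: "b * x = a * x"
    using assms(6,7) by (simp_all add: x_def y_def)
  have x: "is_wcore_inverse star m a x"
    using assms(4) wcore_inverse_eqI[OF m] by (auto simp: wcore_invertible_def x_def)
  have ab: "is_wcore_inverse star m (a * b) (x * x)"
    by (rule is_wcore_inverse_mult[OF m x bx])
  have aa: "is_wcore_inverse star m (a * a) (x * x)"
    by (rule is_wcore_inverse_mult[OF m x refl])
  obtain n where n: "m * n = 1" "n * m = 1"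
    using m(1) by (auto simp: two_sided_unit_def)
  note X = is_wcore_inverse_props[OF n m(2) x]
  have "y * x = y * (a * x * x)"
    by (simp only: X(3))
  also have "\<dots> = x * b * x * x"
    unfolding xb by (simp add: mult.assoc)
  also have "\<dots> = x * (b * x) * x"
    by (simp only: mult.assoc)
  also have "\<dots> = x * (a * x * x)"
    unfolding bx by (simp only: mult.assoc)
  finally have yx: "y * x = x * x"
    by (simp only: X(3))
  have "a * b \<in> wcore_invertible star m" "a * a \<in> wcore_invertible star m"
    using ab aa by (auto simp: wcore_invertible_def)
  then show ?thesis
    using wcore_inverse_eqI[OF m ab] wcore_inverse_eqI[OF m aa] yx
    by (simp add: power2_eq_square x_def y_def)
qed

end
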